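(* Suppose that for all coprime integers $p>q\ge 1$ the following holds: for every $u\in\mathcal{L}_{p/q}$, the infinite word $\mathtt{wmax}_{p/q}(u)$ is normal over the alphabet $\{p-q,\dots,p-1\}$, and for every $u\in\mathcal{L}_{p/q}$ with $u\neq\epsilon$, the infinite word $\mathtt{wmin}_{p/q}(u)$ is normal over the alphabet $\{0,\dots,q-1\}$. Then for all coprime integers $p>q>1$, every nonempty proper subset $S\subsetneq\{0,\dots,q-1\}$ and every starting positive integer $x_0$, the sequence of iterates, starting from $x_0$, of the map $$x\mapsto\begin{cases}\lceil px/q\rceil, & \text{if } x\equiv s \bmod q \text{ for some } s\in S,\\ \text{STOP}, & \text{otherwise,}\end{cases}$$ terminates (i.e. reaches STOP after finitely many steps).
   Context: Here $\mathbb{N}=\{0,1,2,\dots\}$. Rational base expansions. Let $p>q\ge 1$ be coprime integers. The expansion $\mathtt{rep}_{p/q}(n)$ of $n\in\mathbb{N}$ in base $p/q$ is the unique finite word $a_ka_{k-1}\cdots a_0$ over $\{0,\dots,p-1\}$ not starting with the letter $0$ and such that $n=\frac1q\sum_{i=0}^k a_i\left(\frac pq\right)^i$ (the expansion of $0$ is the empty word $\epsilon$). Put $\mathcal{L}_{p/q}=\{\mathtt{rep}_{p/q}(n): n\in\mathbb{N}\}$. This language is prefix-closed, and every word of it can be extended on the right by some letter of $\{0,\dots,p-1\}$ to a word of $\mathcal{L}_{p/q}$. Minimal and maximal words. For $u\in\mathcal{L}_{p/q}$, the minimal (resp. maximal) word with seed $u$, denoted $\mathtt{wmin}_{p/q}(u)$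 (resp. $\mathtt{wmax}_{p/q}(u)$), is the unique infinite word such that, for every $l\in\mathbb{N}$, its prefix of length $l$ is the lexicographically smallest (resp. largest) word $v\in\{0,\dots,p-1\}^l$ such that the concatenation $uv$ belongs to $\mathcal{L}_{p/q}$. (Equivalently, it is built letter by letter, starting from $u$, by always appending the smallest (resp. largest) letter keeping the word in $\mathcal{L}_{p/q}$.) Normality. An infinite word $w=w_0w_1w_2\cdots$ over an alphabet $A$ with $d$ letters is normal over $A$ if for every $l\ge 1$ and every $v\in A^l$, $\lim_{N\to\infty}\frac1N\,\mathrm{Card}\{0\le m<N : w_m\cdots w_{m+l-1}=v\}=\frac{1}{d^l}$. *)

theory Defs
  imports Complex_Main "HOL-Number_Theory.Cong"
begin

text \<open>Finite words are lists with the most significant digit first; infinite words are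
  functions on the natural numbers. The letter \<open>a\<^sub>i\<close> of the word \<open>a\<^sub>k \<dots> a\<^sub>0\<close> is thus \<open>rev w ! i\<close>.\<close>

definition val :: "nat \<Rightarrow> nat \<Rightarrow> nat list \<Rightarrow> real" where
  "val p q w = 1 / real q * (\<Sum>i<length w. real (rev w ! i) * (real p / real q) ^ i)"

definition rep :: "nat \<Rightarrow> nat \<Rightarrow> nat \<Rightarrow> nat list" where
  "rep p q n = (THE w. set w \<subseteq> {0..p - 1} \<and> (w \<noteq> [] \<longrightarrow> hd w \<noteq> 0) \<and> real n = val p q w)"

definition rep_lang :: "nat \<Rightarrow> nat \<Rightarrow> nat list set" where
  "rep_lang p q = range (rep p q)"

definition lex_le :: "nat list \<Rightarrow> nat list \<Rightarrow> bool" where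
  "lex_le v v' \<longleftrightarrow> v = v' \<or> (v, v') \<in> lex less_than"

definition extensions :: "nat \<Rightarrow> nat \<Rightarrow> nat list \<Rightarrow> nat \<Rightarrow> nat list set" where
  "extensions p q u l = {v. length v = l \<and> set v \<subseteq> {0..p - 1} \<and> u @ v \<in> rep_lang p q}"

definition prefix_of :: "(nat \<Rightarrow> 'a) \<Rightarrow> nat \<Rightarrow> 'a list" where
  "prefix_of w l = map w [0..<l]"

definition wmin :: "nat \<Rightarrow> nat \<Rightarrow> nat list \<Rightarrow> nat \<Rightarrow> nat" where
  "wmin p q u = (THE w. \<forall>l. prefix_of w l \<in> extensions p q u l \<and>
     (\<forall>v \<in> extensions p q u l. lex_le (prefix_of w l) v))"

definition wmax :: "nat \<Rightarrow> nat \<Rightarrow> nat list \<Rightarrow> nat \<Rightarrow> nat" where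
  "wmax p q u = (THE w. \<forall>l. prefix_of w l \<in> extensions p q u l \<and>
     (\<forall>v \<in> extensions p q u l. lex_le v (prefix_of w l)))"

text \<open>Normality over \<open>A\<close> includes that \<open>w\<close> is a word over \<open>A\<close>, which the
  limit condition alone would not give.\<close>

definition normal_over :: "'a set \<Rightarrow> (nat \<Rightarrow> 'a) \<Rightarrow> bool" where
  "normal_over A w \<longleftrightarrow> range w \<subseteq> A \<and>
     (\<forall>l\<ge>1. \<forall>v. length v = l \<and> set v \<subseteq> A \<longrightarrow>
       (\<lambda>N. real (card {m. m < N \<and> map w [m..<m + l] = v}) / real N)
         \<longlonglongrightarrow> 1 / real (card A) ^ l)"

text \<open>\<open>None\<close> stands for STOP.\<close>

definition ceil_step :: "nat \<Rightarrow> nat \<Rightarrow> nat set \<Rightarrow> nat \<Rightarrow> nat option" where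
  "ceil_step p q S x =
     (if \<exists>s\<in>S. [x = s] (mod q) then Some (nat \<lceil>real p * real x / real q\<rceil>) else None)"

definition iterate :: "nat \<Rightarrow> nat \<Rightarrow> nat set \<Rightarrow> nat \<Rightarrow> nat \<Rightarrow> nat option" where
  "iterate p q S x\<^sub>0 n = ((\<lambda>y. Option.bind y (ceil_step p q S)) ^^ n) (Some x\<^sub>0)"

definition terminates :: "nat \<Rightarrow> nat \<Rightarrow> nat set \<Rightarrow> nat \<Rightarrow> bool" where
  "terminates p q S x\<^sub>0 \<longleftrightarrow> (\<exists>n. iterate p q S x\<^sub>0 n = None)"

end

theory Submission
  imports Defs
begin

text \<open>Appending a letter \<open>a < p\<close> to the expansion of \<open>n > 0\<close> gives a word of value
  \<open>(p n + a) / q\<close>. The extended word lies in the language exactly when this value is an integer, so the smallest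
  admissible letter is the one that rounds \<open>p n / q\<close> up to the next integer. Hence the minimal word
  with seed \<open>rep p q x\<close> records, letter by letter, the orbit of \<open>x\<close> under
  \<open>y \<mapsto> \<lceil>p y / q\<rceil>\<close>: its letter at position \<open>n\<close> is \<open>- p y mod q\<close>, where \<open>y\<close> is the \<open>n\<close>-th iterate
  (lemma \<open>wmin_rep\<close>). As \<open>p\<close> is invertible modulo \<open>q\<close>, this letter determines \<open>y\<close> modulo \<open>q\<close>
  (lemma \<open>letter_determines_residue\<close>).

  If the iteration never stops, then the orbit avoids the residue class of every
  \<open>r \<in> {0..q - 1} - S\<close>, and the minimal word avoids the corresponding letter. A normal word contains
  every letter with frequency \<open>1 / q > 0\<close>, a contradiction.

  Making this precise requires that \<open>rep\<close> and \<open>wmin\<close>, defined by unique description, satisfy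
  their descriptions. The arithmetic core is that a prefix of a word with integer value has integer
  value (lemma \<open>val_integral\<close>), which makes the letters of an expansion computable from the right as
  residues modulo \<open>p\<close>.\<close>

section \<open>Values of words\<close>

lemma val_snoc:
  assumes "q > 0"
  shows "val p q (w @ [a]) = (real p * val p q w + real a) / real q"
proof -
  have "(\<Sum>i<length (w @ [a]). real (rev (w @ [a]) ! i) * (real p / real q) ^ i)
      = real a + real p / real q * (\<Sum>i<length w. real (rev w ! i) * (real p / real q) ^ i)"
    by (simp add: sum.lessThan_Suc_shift sum_distrib_left mult_ac del: sum.lessThan_Suc)
  then show ?thesis
    unfolding val_def using assms by (simp add: field_simps)
qed

lemma val_denominator_power:
  assumes "q > 0"
  shows "\<exists>k m. val p q w * real q ^ k = real m"
proof (induction w rule: rev_induct)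
  case Nil
  show ?case by (rule exI[of _ 0], rule exI[of _ 0]) (simp add: val_def)
next
  case (snoc a w)
  then obtain k m where km: "val p q w * real q ^ k = real m" by blast
  have "val p q (w @ [a]) * real q ^ Suc k = real p * (val p q w * real q ^ k) + real a * real q ^ k"
    using assms by (simp add: val_snoc field_simps)
  also have "\<dots> = real (p * m + a * q ^ k)"
    by (simp add: km)
  finally show ?case by blast
qed

lemma val_nonneg: "val p q w \<ge> 0"
  unfolding val_def by (intro mult_nonneg_nonneg sum_nonneg) auto

text \<open>The denominator of \<open>val p q w\<close> divides a power of \<open>q\<close> as well as \<open>p\<close>, and these
  are coprime. For a word of integer value, the hypothesis holds at its prefix, since
  \<open>p * val p q w = q * val p q (w @ [a]) - a\<close>.\<close>

lemma val_integral:
  assumes "coprime p q" "q > 0" "p > 0" "real p * val p q w = of_int z"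
  obtains n where "val p q w = real n"
proof -
  obtain k m where km: "val p q w * real q ^ k = real m"
    using val_denominator_power[OF assms(2)] by blast
  have "real_of_int (int p * int m) = real_of_int (z * int q ^ k)"
    using assms(4) by (simp flip: km)
  then have "int p * int m = z * int q ^ k" by (simp only: of_int_eq_iff)
  then have "int p dvd z * int q ^ k" by (metis dvd_triv_left)
  moreover have "coprime (int p) (int q ^ k)" using assms(1) by simp
  ultimately have "int p dvd z" by (simp add: coprime_dvd_mult_left_iff)
  then obtain y where "z = int p * y" by blast
  with assms have y: "val p q w = of_int y" by simp
  then have "y \<ge> 0" using val_nonneg[of p q w] by simp
  with y have "val p q w = real (nat y)" by simp
  then show ?thesis by (rule that)
qed

section \<open>Existence and uniqueness of expansions\<close>

locale rational_base =
  fixes p q :: nat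
  assumes coprime_pq: "coprime p q" and q_ge_1: "1 \<le> q" and q_less_p: "q < p"
begin

definition expansion :: "nat list \<Rightarrow> nat \<Rightarrow> bool" where
  "expansion w n \<longleftrightarrow> set w \<subseteq> {0..p - 1} \<and> (w \<noteq> [] \<longrightarrow> hd w \<noteq> 0) \<and> real n = val p q w"

lemma expansion_Nil: "expansion [] n \<longleftrightarrow> n = 0"
  by (simp add: expansion_def val_def)

lemma expansion_snoc:
  "expansion (w @ [a]) n \<longleftrightarrow>
     a < p \<and> (w = [] \<longrightarrow> a \<noteq> 0) \<and> (\<exists>m. expansion w m \<and> q * n = p * m + a)"
proof
  assume e: "expansion (w @ [a]) n"
  have "real n = (real p * val p q w + real a) / real q"
    using e q_ge_1 by (simp add: expansion_def val_snoc)
  then have v: "real q * real n = real p * val p q w + real a"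
    using q_ge_1 by (simp add: field_simps)
  then have "real p * val p q w = of_int (int q * int n - int a)" by simp
  with val_integral[OF coprime_pq] q_ge_1 q_less_p obtain m where m: "val p q w = real m"
    by (metis gr0I less_nat_zero_code not_one_le_zero)
  with v have "real (q * n) = real (p * m + a)" by simp
  then have "q * n = p * m + a" by (simp only: of_nat_eq_iff)
  with e m q_less_p show "a < p \<and> (w = [] \<longrightarrow> a \<noteq> 0) \<and> (\<exists>m. expansion w m \<and> q * n = p * m + a)"
    by (cases w) (auto simp: expansion_def)
next
  assume "a < p \<and> (w = [] \<longrightarrow> a \<noteq> 0) \<and> (\<exists>m. expansion w m \<and> q * n = p * m + a)"
  then obtain m where a: "a < p" "w = [] \<longrightarrow> a \<noteq> 0" and m: "expansion w m" "q * n = p * m + a"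
    by blast
  have "real q * real n = real p * real m + real a"
    using m(2) by (metis of_nat_add of_nat_mult)
  then have "real n = val p q (w @ [a])"
    using m(1) q_ge_1 by (simp add: val_snoc expansion_def field_simps)
  with a m(1) show "expansion (w @ [a]) n"
    by (cases w) (auto simp: expansion_def)
qed

lemma expansion_zero: "expansion w 0 \<Longrightarrow> w = []"
proof (induction w rule: rev_induct)
  case (snoc a w)
  then show ?case using q_less_p by (auto simp: expansion_snoc)
qed simp

text \<open>The last letter of an expansion of \<open>n\<close> is \<open>q * n mod p\<close>, and the rest is an expansion of
  \<open>q * n div p\<close>. This gives uniqueness and, since \<open>q * n div p < n\<close>, also existence.\<close>

lemma expansion_unique: "expansion w n \<Longrightarrow> expansion w' n \<Longrightarrow> w = w'"
proof (induction w arbitrary: n w' rule: rev_induct)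
  case Nil
  then show ?case using expansion_zero[of w'] by (simp add: expansion_Nil)
next
  case (snoc a w)
  from snoc.prems(1) obtain m where m: "a < p" "expansion w m" "q * n = p * m + a"
    by (auto simp: expansion_snoc)
  have "w' \<noteq> []"
    using snoc.prems expansion_zero[of "w @ [a]"] by (auto simp: expansion_Nil)
  then obtain v b where w': "w' = v @ [b]" by (metis rev_exhaust)
  with snoc.prems(2) obtain k where k: "b < p" "expansion v k" "q * n = p * k + b"
    by (auto simp: expansion_snoc)
  have "a = b" using m(1,3) k(1,3) by (metis mod_mult_self4 mod_less)
  moreover from this have "m = k" using m k by auto
  ultimately show ?case using snoc.IH m k w' by blast
qed

lemma expansion_exists: "\<exists>w. expansion w n"
proof (induction n rule: less_induct)
  case (less n)
  show ?case
  proof (cases "n = 0")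
    case True
    then show ?thesis using expansion_Nil by blast
  next
    case False
    have "q * n < n * p" using False q_less_p by simp
    then have "q * n div p < n" by (simp add: less_mult_imp_div_less)
    then obtain w where w: "expansion w (q * n div p)" using less by blast
    have "q * n mod p \<noteq> 0" if "w = []"
      using w that False q_ge_1 mult_div_mod_eq[of p "q * n"] by (auto simp: expansion_Nil)
    moreover have "q * n mod p < p" using q_less_p by simp
    ultimately have "expansion (w @ [q * n mod p]) n"
      unfolding expansion_snoc using w mult_div_mod_eq[of p "q * n"] by auto
    then show ?thesis by blast
  qed
qed

lemma expansion_rep: "expansion (rep p q n) n"
proof -
  have "\<exists>!w. expansion w n" using expansion_exists expansion_unique by blast
  from theI'[OF this] show ?thesis by (simp add: rep_def expansion_def)
qed

lemma rep_lang_iff: "w \<in> rep_lang p q \<longleftrightarrow> (\<exists>n. expansion w n)"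
  unfolding rep_lang_def using expansion_rep expansion_unique by blast

lemma extensions_snoc:
  assumes "u \<noteq> []"
  shows "v @ [a] \<in> extensions p q u (Suc l) \<longleftrightarrow>
    v \<in> extensions p q u l \<and> a < p \<and> (\<exists>m n. expansion (u @ v) m \<and> q * n = p * m + a)"
proof -
  have "u @ v @ [a] \<in> rep_lang p q \<longleftrightarrow>
      a < p \<and> (\<exists>m n. expansion (u @ v) m \<and> q * n = p * m + a)"
    using assms expansion_snoc[of "u @ v" a] by (auto simp: rep_lang_iff)
  then show ?thesis
    by (auto simp: extensions_def rep_lang_iff)
qed

section \<open>The letter that rounds up\<close>

definition ceil_next :: "nat \<Rightarrow> nat" where
  "ceil_next y = nat \<lceil>real p * real y / real q\<rceil>"

definition min_letter :: "nat \<Rightarrow> nat" where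
  "min_letter y = q * ceil_next y - p * y"

lemma ceil_next_le:
  assumes "q * n = p * y + b"
  shows "ceil_next y \<le> n"
proof -
  have "real q * real n = real p * real y + real b"
    using assms by (metis of_nat_add of_nat_mult)
  then have "real p * real y / real q \<le> real n"
    using q_ge_1 by (simp add: field_simps)
  then show ?thesis unfolding ceil_next_def by (simp add: ceiling_le_iff)
qed

lemma min_letter: "q * ceil_next y = p * y + min_letter y" "min_letter y < q"
proof -
  let ?r = "real p * real y / real q"
  have c: "real (ceil_next y) = of_int \<lceil>?r\<rceil>"
    unfolding ceil_next_def by simp
  have "?r \<le> real (ceil_next y)" "real (ceil_next y) < ?r + 1"
    using ceiling_correct[of ?r] by (simp_all add: c)
  then have "real (p * y) \<le> real (q * ceil_next y)" "real (q * ceil_next y) < real (p * y + q)"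
    using q_ge_1 by (simp_all add: field_simps)
  then show "q * ceil_next y = p * y + min_letter y" "min_letter y < q"
    unfolding of_nat_le_iff of_nat_less_iff min_letter_def by linarith+
qed

lemma min_letter_le: "q * n = p * y + b \<Longrightarrow> min_letter y \<le> b"
  using ceil_next_le[of n y b] mult_le_mono2[of "ceil_next y" n q] by (simp add: min_letter_def)

text \<open>The letter is congruent to \<open>- p * y\<close> modulo \<open>q\<close>, and \<open>p\<close> is invertible modulo \<open>q\<close>.\<close>

lemma letter_determines_residue:
  assumes "min_letter y = min_letter z"
  shows "[y = z] (mod q)"
proof -
  have "p * y + min_letter y + q * ceil_next z = p * z + min_letter z + q * ceil_next y"
    using min_letter(1)[of y] min_letter(1)[of z] by simp
  then have "p * y + q * ceil_next z = p * z + q * ceil_next y"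
    using assms by simp
  then have "[p * y = p * z] (mod q)"
    unfolding cong_def by (metis mod_mult_self2)
  then show ?thesis
    using coprime_pq by (simp add: cong_mult_lcancel_nat)
qed

end

section \<open>Minimal words\<close>

lemma lex_le_antisym:
  assumes "lex_le v w" "lex_le w v"
  shows "v = w"
proof (rule ccontr)
  assume "v \<noteq> w"
  with assms have "(v, w) \<in> lex less_than" "(w, v) \<in> lex less_than"
    by (auto simp: lex_le_def)
  moreover have "trans (lex (less_than :: nat rel))"
    by (simp add: lex_transI)
  moreover have "irrefl (lex (less_than :: nat rel))"
    by (simp add: irrefl_lex irrefl_less_than)
  ultimately show False by (meson irreflD transD)
qed

lemma lex_le_snoc:
  assumes "lex_le v w" "v = w \<Longrightarrow> a \<le> b" "length v = length w"
  shows "lex_le (v @ [a]) (w @ [b])"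
proof (cases "v = w")
  case True
  with assms(2) have "a \<le> b" by simp
  then show ?thesis
    using True by (auto simp: lex_le_def intro!: lex_append_leftI)
next
  case False
  with assms have "(v, w) \<in> lex less_than" by (simp add: lex_le_def)
  with assms(3) show ?thesis
    by (auto simp: lex_le_def intro!: lex_append_rightI)
qed

lemma prefix_of_Suc: "prefix_of w (Suc l) = prefix_of w l @ [w l]"
  by (simp add: prefix_of_def)

lemma prefix_of_inject:
  assumes "\<And>l. prefix_of w l = prefix_of w' l"
  shows "w = w'"
proof
  fix n
  show "w n = w' n" using assms[of "Suc n"] by (simp add: prefix_of_def)
qed

lemma wmin_eqI:
  assumes "\<And>l. prefix_of w l \<in> extensions p q u l"
    and "\<And>l v. v \<in> extensions p q u l \<Longrightarrow> lex_le (prefix_of w l) v"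
  shows "wmin p q u = w"
  unfolding wmin_def
proof (rule the_equality)
  fix w' assume "\<forall>l. prefix_of w' l \<in> extensions p q u l \<and>
     (\<forall>v \<in> extensions p q u l. lex_le (prefix_of w' l) v)"
  with assms show "w' = w" by (intro prefix_of_inject lex_le_antisym) blast+
qed (use assms in blast)

context rational_base
begin

text \<open>Among words of the same length, a lexicographic minimum can be built greedily because the
  language is prefix-closed; each greedy step uses the letter that rounds up.\<close>

lemma wmin_rep:
  assumes "x > 0"
  shows "wmin p q (rep p q x) = (\<lambda>n. min_letter ((ceil_next ^^ n) x))"
proof -
  let ?u = "rep p q x" and ?y = "\<lambda>n. (ceil_next ^^ n) x"
  let ?w = "\<lambda>n. min_letter (?y n)"
  have u: "?u \<noteq> []"
    using expansion_rep[of x] assms by (auto simp: expansion_Nil)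
  have expand: "expansion (?u @ prefix_of ?w l) (?y l)" for l
  proof (induction l)
    case 0
    show ?case using expansion_rep by (simp add: prefix_of_def)
  next
    case (Suc l)
    have "?w l < p" using min_letter(2)[of "?y l"] q_less_p by simp
    then show ?case
      using Suc u min_letter(1)[of "?y l"] expansion_snoc[of "?u @ prefix_of ?w l" "?w l"]
      by (auto simp: prefix_of_Suc)
  qed
  have ext: "prefix_of ?w l \<in> extensions p q ?u l" for l
    using expand[of l] by (auto simp: extensions_def rep_lang_iff expansion_def prefix_of_def)
  have least: "lex_le (prefix_of ?w l) v" if "v \<in> extensions p q ?u l" for l v
    using that
  proof (induction l arbitrary: v)
    case 0
    then show ?case by (simp add: extensions_def lex_le_def prefix_of_def)
  next
    case (Suc l)
    then have "length v = Suc l" by (simp add: extensions_def)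
    then obtain v' b where v: "v = v' @ [b]" by (metis append_butlast_last_id list.size(3) nat.distinct(1))
    with Suc.prems u obtain m n where v': "v' \<in> extensions p q ?u l"
      and mn: "expansion (?u @ v') m" "q * n = p * m + b"
      by (auto simp: extensions_snoc)
    have "?w l \<le> b" if "prefix_of ?w l = v'"
    proof -
      \<comment> \<open>Both are the value of the same word.\<close>
      have "real m = real (?y l)" using mn(1) expand[of l] that by (simp add: expansion_def)
      then show ?thesis using mn(2) min_letter_le by simp
    qed
    moreover have "length (prefix_of ?w l) = length v'"
      using v' by (simp add: extensions_def prefix_of_def)
    ultimately show ?case
      unfolding v prefix_of_Suc using Suc.IH[OF v'] by (intro lex_le_snoc)
  qed
  show ?thesis using ext least by (rule wmin_eqI)
qed

section \<open>Normality forces termination\<close>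

lemma iterate_not_None:
  assumes "iterate p q S x n \<noteq> None"
  shows "iterate p q S x n = Some ((ceil_next ^^ n) x)"
  using assms
proof (induction n)
  case 0
  show ?case by (simp add: iterate_def)
next
  case (Suc n)
  have step: "iterate p q S x (Suc n) = Option.bind (iterate p q S x n) (ceil_step p q S)"
    by (simp add: iterate_def)
  with Suc.prems have "iterate p q S x n \<noteq> None" by (metis bind.bind_lzero)
  with Suc step show ?case
    by (auto simp: ceil_step_def ceil_next_def split: if_splits)
qed

lemma orbit_residue_if_not_terminates:
  assumes "\<not> terminates p q S x"
  shows "\<exists>s\<in>S. [(ceil_next ^^ n) x = s] (mod q)"
proof -
  have "iterate p q S x n \<noteq> None" "iterate p q S x (Suc n) \<noteq> None"
    using assms by (auto simp: terminates_def)
  moreover have "iterate p q S x (Suc n) = Option.bind (iterate p q S x n) (ceil_step p q S)"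
    by (simp add: iterate_def)
  ultimately show ?thesis
    using iterate_not_None[of S x n] by (auto simp: ceil_step_def split: if_splits)
qed

end

lemma normal_over_letter_occurs:
  assumes "normal_over A w" "finite A" "a \<in> A"
  shows "\<exists>n. w n = a"
proof (rule ccontr)
  assume no: "\<nexists>n. w n = a"
  have "length [a] = 1" "set [a] \<subseteq> A" using assms(3) by simp_all
  then have "(\<lambda>N. real (card {m. m < N \<and> map w [m..<m + 1] = [a]}) / real N)
      \<longlonglongrightarrow> 1 / real (card A) ^ 1"
    using assms(1) unfolding normal_over_def by blast
  moreover have "{m. m < N \<and> map w [m..<m + 1] = [a]} = {}" for N
    using no by simp
  ultimately have "(\<lambda>N. 0) \<longlonglongrightarrow> 1 / real (card A) ^ 1"
    by (simp only: card.empty of_nat_0 div_0)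
  then have "1 / real (card A) = 0"
    by (simp add: LIMSEQ_const_iff)
  with assms(2,3) show False by auto
qed

theorem proposition3p13:
  assumes "\<forall>p q :: nat. coprime p q \<and> p > q \<and> q \<ge> 1 \<longrightarrow>
      (\<forall>u \<in> rep_lang p q. normal_over {p - q..p - 1} (wmax p q u)) \<and>
      (\<forall>u \<in> rep_lang p q. u \<noteq> [] \<longrightarrow> normal_over {0..q - 1} (wmin p q u))"
  shows "\<forall>p q :: nat. coprime p q \<and> p > q \<and> q > 1 \<longrightarrow>
      (\<forall>S x\<^sub>0. S \<noteq> {} \<and> S \<subset> {0..q - 1} \<and> x\<^sub>0 > 0 \<longrightarrow> terminates p q S x\<^sub>0)"
proof (intro allI impI, elim conjE)
  fix p q :: nat and S :: "nat set" and x :: nat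
  assume pq: "coprime p q" "p > q" "q > 1" and S: "S \<subset> {0..q - 1}" and x: "x > 0"
  interpret rational_base p q by unfold_locales (use pq in auto)
  show "terminates p q S x"
  proof (rule ccontr)
    assume nt: "\<not> terminates p q S x"
    obtain r where r: "r < q" "r \<notin> S" using S pq(3) by fastforce
    have "rep p q x \<noteq> []" using expansion_rep[of x] x by (auto simp: expansion_Nil)
    moreover have "rep p q x \<in> rep_lang p q" by (simp add: rep_lang_def)
    ultimately have "normal_over {0..q - 1} (wmin p q (rep p q x))"
      using assms pq by simp
    moreover have "min_letter r \<in> {0..q - 1}" using min_letter(2)[of r] by simp
    ultimately obtain n where "wmin p q (rep p q x) n = min_letter r"
      using normal_over_letter_occurs[OF _ finite_atLeastAtMost] by blast
    then have "[(ceil_next ^^ n) x = r] (mod q)"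
      using x by (simp add: wmin_rep letter_determines_residue)
    moreover obtain s where s: "s \<in> S" "[(ceil_next ^^ n) x = s] (mod q)"
      using orbit_residue_if_not_terminates[OF nt] by blast
    ultimately have "[r = s] (mod q)" by (metis cong_sym cong_trans)
    moreover have "s < q" using s(1) S pq(3) by fastforce
    ultimately have "r = s" using r(1) by (simp add: cong_def)
    with r s show False by simp
  qed
qed

end
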